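(* Consider the iterates of the distributed alternating gradient descent algorithm (specified in the context) and let $\hat{x}^{k}:=\frac1V\sum_{i\in[V]}x_i^{k}$. At any node $i\in[V]$ and at the $k$-th outer iteration of the algorithm, $$\|\hat{x}^{k+1}-x_i^{k+1}\|\le\mathcal{E}_k,$$ where $$\mathcal{E}_k:=V\theta\sum_{s=1}^{k-1}\beta^{k-s-1}\left(2\gamma_sG_F+\frac{\eta_s}{G_0}\right)+\theta\beta^{k-1}\sum_{j\in[V]}\|x_j^1\|+2\left(2\gamma_kG_F+\frac{\eta_k}{G_0}\right),$$ with $\theta=\left(1-\frac{\alpha}{4V^2}\right)^{-2}$ and $\beta=\left(1-\frac{\alpha}{4V^2}\right)^{1/Q}$. As a consequence, $\|x_j^{k+1}-x_i^{k+1}\|\le2\mathcal{E}_k$ for all $i,j\in[V]$.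
   Context: Notation: $[V]=\{1,\dots,V\}$; $\|\cdot\|$ is the Euclidean norm; $\mathrm{proj}_S$ is Euclidean projection onto the closed set $S$. Problem (P): minimize $F(x):=\sum_{i=1}^{V}F_i(x)$ subject to $x\in\mathbb{X}$ and $f(x,u)\le 0$ for all $u\in\mathbb{U}$. Here $\mathbb{X}\subset\mathbb{R}^{n}$ is compact and convex with non-empty interior and diameter $D:=\max_{a,b\in\mathbb{X}}\|a-b\|$; each $F_i:\mathbb{X}\to\mathbb{R}$ is convex and subdifferentiable; $\mathbb{U}\subset\mathbb{R}^{m}$ is compact; $f:\mathbb{X}\times\mathbb{U}\to\mathbb{R}$ is continuous, and is convex and continuously differentiable in $x$ for each fixed $u$. $\nabla_x f$ is the gradient in the first variable. $F_i'(x)$ denotes a subgradient of $F_i$ at $x$, i.e. $F_i'(x)^\top(b-x)\le F_i(b)-F_i(x)$ for all $b\in\mathbb{X}$. The feasible set is $\mathbb{F}:=\{x\in\mathbb{X}: f(x,u)\le 0\ \forall u\in\mathbb{U}\}$. Standing regularity assumptions: (A1) there is $\bar{x}\in\mathbb{F}$ with $f(\bar{x},u)<0$ for all $u\in\mathbb{U}$. (A2) $G_F:=\max_{i\in[V]}\max_{x\in\mathbb{X}}\|F_i'(x)\|<+\infty$ (subgradients are bounded). (A3) $G_f:=\max_{x\in\mathbb{X},u\in\mathbb{U}}\|\nabla_x f(x,u)\|<+\infty$. Moreover $G_0>0$ is a constant such that $\|\nabla_x f(x,u^* )\|\ge G_0$ for all $x\in\mathbb{X}$ with $\max_{u\in\mathbb{U}}f(x,u)=0$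 and all $u^*\in\arg\max_{u\in\mathbb{U}}f(x,u)$ (such a constant exists by (A1)). Network: $V$ nodes $[V]$, and for each time $k\in\mathbb{N}$ a directed graph with edge set $E_k\subset[V]\times[V]$ and weight matrix $A_k=(a^k_{ij})\in\mathbb{R}^{V\times V}$, $a^k_{ij}\in[0,1]$, with $a^k_{ij}>0$ iff $(i,j)\in E_k$. Standing properties: (G1) each $A_k$ is doubly stochastic; (G2) there is $0<\alpha<1$ such that $a^k_{ij}>0$ implies $a^k_{ij}\ge\alpha$; (G3) there is an integer $Q>0$ such that for every $k\ge1$ the graph on $[V]$ with edge set $\bigcup_{\tau=0}^{Q-1}E_{k+\tau}$ is strongly connected. Algorithm (distributed alternating gradient descent): let $K\in\mathbb{N}$ be the number of outer iterations, $\eta_k:=1/\sqrt{k}$ the feasibility tolerances and $\gamma_k:=D/\sqrt{k}$ the outer stepsizes. Each node $i$ has an initial guess $x_i^1\in\mathbb{X}$. For $k=1,\dots,K$, each node $i\in[V]$ does: 1. $v_i^k:=\sum_{j=1}^{V}a^k_{ij}x_j^k$. 2. $z_i^k:=\mathrm{proj}_{\mathbb{X}}\big(v_i^k-\gamma_kF_i'(v_i^k)\big)$. 3. Set $\ell=1$, $\bar z_i^{k,1}:=z_i^k$, $\bar u_i^{k,1}\in\arg\max_{u\in\mathbb{U}}f(z_i^k,u)$ and $\mathbb{B}_i^k:=\{x\in\mathbb{X}:\|x-z_i^k\|\le\gamma_kG_F+\eta_k/G_0\}$. 4. (Inner descent loop) While $f(\bar z_i^{k,\ell},\bar u_i^{k,\ell})>\eta_{k+1}$: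 set $s_i^{k,\ell}:=f(\bar z_i^{k,\ell},\bar u_i^{k,\ell})/\|\nabla_xf(\bar z_i^{k,\ell},\bar u_i^{k,\ell})\|^2$, $\bar z_i^{k,\ell+1}:=\mathrm{proj}_{\mathbb{B}_i^k}\big(\bar z_i^{k,\ell}-s_i^{k,\ell}\nabla_xf(\bar z_i^{k,\ell},\bar u_i^{k,\ell})\big)$, $\bar u_i^{k,\ell+1}\in\arg\max_{u\in\mathbb{U}}f(\bar z_i^{k,\ell+1},u)$, and $\ell\leftarrow\ell+1$. 5. $x_i^{k+1}:=\bar z_i^{k,\ell}$ for the final $\ell$.
   Formalization: Added assumption: every node has a self-loop, (i,i) in E_k for all k ≥ 1 (so a^k_ii ≥ α). Without it the claim fails: for V=2 with weight matrices that swap the two nodes, the deviation can stay 1 while the bound tends to 0. *)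

theory Defs
  imports "HOL-Analysis.Analysis"
begin

definition subgradient_at :: "(real^'n) set \<Rightarrow> (real^'n \<Rightarrow> real) \<Rightarrow> real^'n \<Rightarrow> real^'n \<Rightarrow> bool" where
  "subgradient_at X h x g \<longleftrightarrow> (\<forall>b\<in>X. g \<bullet> (b - x) \<le> h b - h x)"

definition feasible_set ::
    "(real^'n) set \<Rightarrow> (real^'m) set \<Rightarrow> (real^'n \<Rightarrow> real^'m \<Rightarrow> real) \<Rightarrow> (real^'n) set" where
  "feasible_set X U f = {x\<in>X. \<forall>u\<in>U. f x u \<le> 0}"

(* A supremum: the chosen subgradients F' i x need not depend continuously on x, so the maximum
   need not be attained.  Boundedness is an assumption of the locale below. *)
definition subgrad_bound :: "nat \<Rightarrow> (real^'n) set \<Rightarrow> (nat \<Rightarrow> real^'n \<Rightarrow> real^'n) \<Rightarrow> real" where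
  "subgrad_bound V X F' = (SUP (i, x)\<in>{1..V} \<times> X. norm (F' i x))"

(* gradf x u is the gradient of f in its first variable; it is determined by has_gradient, since
   derivatives within a convex set with non-empty interior are unique. *)
locale semi_infinite_problem =
  fixes V :: nat
    and X :: "(real^'n) set"
    and U :: "(real^'m) set"
    and F :: "nat \<Rightarrow> real^'n \<Rightarrow> real"
    and F' :: "nat \<Rightarrow> real^'n \<Rightarrow> real^'n"
    and f :: "real^'n \<Rightarrow> real^'m \<Rightarrow> real"
    and gradf :: "real^'n \<Rightarrow> real^'m \<Rightarrow> real^'n"
    and G0 :: real
  assumes V_pos: "V \<ge> 1"
    and compact_X: "compact X"
    and convex_X: "convex X"
    and interior_X: "interior X \<noteq> {}"
    and convex_F: "i \<in> {1..V} \<Longrightarrow> convex_on X (F i)"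
    and subgradient_F: "i \<in> {1..V} \<Longrightarrow> x \<in> X \<Longrightarrow> subgradient_at X (F i) x (F' i x)"
    and compact_U: "compact U"
    and continuous_f: "continuous_on (X \<times> U) (\<lambda>(x, u). f x u)"
    and convex_f: "u \<in> U \<Longrightarrow> convex_on X (\<lambda>x. f x u)"
    and has_gradient: "u \<in> U \<Longrightarrow> x \<in> X \<Longrightarrow>
          ((\<lambda>y. f y u) has_derivative (\<lambda>h. gradf x u \<bullet> h)) (at x within X)"
    and continuous_gradient: "u \<in> U \<Longrightarrow> continuous_on X (\<lambda>x. gradf x u)"
    and slater: "\<exists>xbar\<in>feasible_set X U f. \<forall>u\<in>U. f xbar u < 0"
    and bounded_subgradients: "bdd_above ((\<lambda>(i, x). norm (F' i x)) ` ({1..V} \<times> X))"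
    and bounded_gradients: "bdd_above ((\<lambda>(x, u). norm (gradf x u)) ` (X \<times> U))"
    and G0_pos: "G0 > 0"
    and G0_bound: "x \<in> X \<Longrightarrow> (SUP u\<in>U. f x u) = 0 \<Longrightarrow> is_arg_max (f x) (\<lambda>u. u \<in> U) ustar
          \<Longrightarrow> norm (gradf x ustar) \<ge> G0"

(* Times are k = 1, 2, ....  Every node always has access to its own state (self_loop), the usual
   convention for averaging networks.  It does not follow from the other assumptions and it is
   indispensable: if V = 2 and every A k is the permutation matrix exchanging the two nodes, all
   the other assumptions hold with Q = 1, but iterated averaging never brings the nodes together. *)
locale consensus_network =
  fixes V :: nat
    and E :: "nat \<Rightarrow> (nat \<times> nat) set"
    and A :: "nat \<Rightarrow> nat \<Rightarrow> nat \<Rightarrow> real"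
    and \<alpha> :: real
    and Q :: nat
  assumes edges: "k \<ge> 1 \<Longrightarrow> E k \<subseteq> {1..V} \<times> {1..V}"
    and self_loop: "k \<ge> 1 \<Longrightarrow> i \<in> {1..V} \<Longrightarrow> (i, i) \<in> E k"
    and weight_range: "k \<ge> 1 \<Longrightarrow> i \<in> {1..V} \<Longrightarrow> j \<in> {1..V} \<Longrightarrow> A k i j \<in> {0..1}"
    and weight_pos_iff: "k \<ge> 1 \<Longrightarrow> i \<in> {1..V} \<Longrightarrow> j \<in> {1..V} \<Longrightarrow> A k i j > 0 \<longleftrightarrow> (i, j) \<in> E k"
    and row_stochastic: "k \<ge> 1 \<Longrightarrow> i \<in> {1..V} \<Longrightarrow> (\<Sum>j\<in>{1..V}. A k i j) = 1"
    and column_stochastic: "k \<ge> 1 \<Longrightarrow> j \<in> {1..V} \<Longrightarrow> (\<Sum>i\<in>{1..V}. A k i j) = 1"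
    and alpha_range: "0 < \<alpha>" "\<alpha> < 1"
    and weight_lower_bound: "k \<ge> 1 \<Longrightarrow> i \<in> {1..V} \<Longrightarrow> j \<in> {1..V} \<Longrightarrow> A k i j > 0 \<Longrightarrow> A k i j \<ge> \<alpha>"
    and Q_pos: "Q > 0"
    and strongly_connected: "k \<ge> 1 \<Longrightarrow> i \<in> {1..V} \<Longrightarrow> j \<in> {1..V}
          \<Longrightarrow> (i, j) \<in> (\<Union>\<tau>\<in>{0..Q - 1}. E (k + \<tau>))\<^sup>*"

definition tolerance :: "nat \<Rightarrow> real" where
  "tolerance k = 1 / sqrt (real k)"

definition stepsize :: "(real^'n) set \<Rightarrow> nat \<Rightarrow> real" where
  "stepsize X k = diameter X / sqrt (real k)"

(* The while loop, started in z0 with the loop test f > tol and projections onto B, can terminate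
   with result y after L - 1 executions of its body.  It is a relation because the maximisers ub l
   are arbitrary and because termination is not asserted. *)
definition inner_descent ::
    "(real^'m) set \<Rightarrow> (real^'n \<Rightarrow> real^'m \<Rightarrow> real) \<Rightarrow> (real^'n \<Rightarrow> real^'m \<Rightarrow> real^'n)
      \<Rightarrow> (real^'n) set \<Rightarrow> real \<Rightarrow> real^'n \<Rightarrow> real^'n \<Rightarrow> bool" where
  "inner_descent U f gradf B tol z0 y \<longleftrightarrow>
     (\<exists>(L::nat) zb ub. L \<ge> 1 \<and> zb 1 = z0
       \<and> (\<forall>l\<in>{1..L}. is_arg_max (f (zb l)) (\<lambda>u. u \<in> U) (ub l))
       \<and> (\<forall>l\<in>{1..<L}. f (zb l) (ub l) > tol
            \<and> zb (l + 1) = closest_point B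
                (zb l - (f (zb l) (ub l) / (norm (gradf (zb l) (ub l)))\<^sup>2) *\<^sub>R gradf (zb l) (ub l)))
       \<and> f (zb L) (ub L) \<le> tol
       \<and> y = zb L)"

(* K completed outer iterations.  The tolerances and stepsizes do not depend on K, so the first K
   iterations of a longer execution form such a run as well, even if a later inner loop diverges. *)
locale dagd_run =
  semi_infinite_problem V X U F F' f gradf G0 + consensus_network V E A \<alpha> Q
  for V :: nat
    and X :: "(real^'n) set"
    and U :: "(real^'m) set"
    and F :: "nat \<Rightarrow> real^'n \<Rightarrow> real"
    and F' :: "nat \<Rightarrow> real^'n \<Rightarrow> real^'n"
    and f :: "real^'n \<Rightarrow> real^'m \<Rightarrow> real"
    and gradf :: "real^'n \<Rightarrow> real^'m \<Rightarrow> real^'n"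
    and G0 :: real
    and E :: "nat \<Rightarrow> (nat \<times> nat) set"
    and A :: "nat \<Rightarrow> nat \<Rightarrow> nat \<Rightarrow> real"
    and \<alpha> :: real
    and Q :: nat +
  fixes K :: nat
    and x :: "nat \<Rightarrow> nat \<Rightarrow> real^'n"
    and v :: "nat \<Rightarrow> nat \<Rightarrow> real^'n"
    and z :: "nat \<Rightarrow> nat \<Rightarrow> real^'n"
  assumes initial: "i \<in> {1..V} \<Longrightarrow> x 1 i \<in> X"
    and averaging: "k \<in> {1..K} \<Longrightarrow> i \<in> {1..V} \<Longrightarrow> v k i = (\<Sum>j\<in>{1..V}. A k i j *\<^sub>R x k j)"
    and outer_step: "k \<in> {1..K} \<Longrightarrow> i \<in> {1..V} \<Longrightarrow>
          z k i = closest_point X (v k i - stepsize X k *\<^sub>R F' i (v k i))"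
    and inner_step: "k \<in> {1..K} \<Longrightarrow> i \<in> {1..V} \<Longrightarrow>
          inner_descent U f gradf
            {y\<in>X. norm (y - z k i) \<le> stepsize X k * subgrad_bound V X F' + tolerance k / G0}
            (tolerance (k + 1)) (z k i) (x (k + 1) i)"

definition node_average :: "nat \<Rightarrow> (nat \<Rightarrow> real^'n) \<Rightarrow> real^'n" where
  "node_average V y = (1 / real V) *\<^sub>R (\<Sum>i\<in>{1..V}. y i)"

definition consensus_theta :: "nat \<Rightarrow> real \<Rightarrow> real" where
  "consensus_theta V \<alpha> = (1 - \<alpha> / (4 * (real V)\<^sup>2)) powi (-2)"

definition consensus_beta :: "nat \<Rightarrow> real \<Rightarrow> nat \<Rightarrow> real" where
  "consensus_beta V \<alpha> Q = (1 - \<alpha> / (4 * (real V)\<^sup>2)) powr (1 / real Q)"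

definition consensus_error ::
    "nat \<Rightarrow> (real^'n) set \<Rightarrow> (nat \<Rightarrow> real^'n \<Rightarrow> real^'n) \<Rightarrow> real \<Rightarrow> real \<Rightarrow> nat
      \<Rightarrow> (nat \<Rightarrow> real^'n) \<Rightarrow> nat \<Rightarrow> real" where
  "consensus_error V X F' G0 \<alpha> Q x1 k =
     (let \<theta> = consensus_theta V \<alpha>; \<beta> = consensus_beta V \<alpha> Q; G\<^sub>F = subgrad_bound V X F' in
        real V * \<theta> *
          (\<Sum>s\<in>{1..k - 1}. \<beta> ^ (k - s - 1) * (2 * stepsize X s * G\<^sub>F + tolerance s / G0))
        + \<theta> * \<beta> ^ (k - 1) * (\<Sum>j\<in>{1..V}. norm (x1 j))
        + 2 * (2 * stepsize X k * G\<^sub>F + tolerance k / G0))"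

end

(* One outer iteration is an averaging step followed by a perturbation e_i^k, and two projections
   bound the perturbation by 2 gamma_k G_F + eta_k / G_0.  Unrolling expresses x^{k+1} through products
   of weight matrices applied to the perturbations, so everything rests on how fast the entries of
   such products approach 1/V.

   For this, compare the sum of squares of a mean-zero vector at the beginning and at the end of a
   block of Q steps.  Each step lowers it by the quadratic form
   1/2 sum_{r,i,j} a_ri a_rj (y_i - y_j)^2.  Let l_0 < ... < l_m be the distinct initial values, and
   wait for the first edge that crosses the cut {i. y_i <= l_d}, in either direction; until then the
   gap between l_d and l_{d+1} remains free.  The step using that edge lowers the sum of squares by at
   least alpha/2 (l_{d+1} - l_d)^2, and the contributions of different cuts add up.  By
   Cauchy-Schwarz the sum of the squared gaps is at least (l_m - l_0)^2 / V, hence at least the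
   initial sum of squares divided by V^2: each block contracts by the factor 1 - alpha/(2 V^2). *)
theory Submission
  imports Defs
begin

section \<open>Sums of squares, gaps between sorted reals, and cuts of a graph\<close>

text \<open>Variance is half the mean squared difference of two independent draws. In this form the
  energy drop of an averaging step becomes a quadratic form in differences of values.\<close>

lemma weighted_variance:
  fixes a y :: "'i \<Rightarrow> real"
  assumes "(\<Sum>i\<in>I. a i) = 1"
  shows "(\<Sum>i\<in>I. a i * (y i)\<^sup>2) - (\<Sum>i\<in>I. a i * y i)\<^sup>2
           = (\<Sum>i\<in>I. \<Sum>j\<in>I. a i * a j * (y i - y j)\<^sup>2) / 2"
proof -
  have "(\<Sum>i\<in>I. \<Sum>j\<in>I. a i * a j * (y i - y j)\<^sup>2)
      = (\<Sum>i\<in>I. \<Sum>j\<in>I. (a i * (y i)\<^sup>2) * a j + a i * (a j * (y j)\<^sup>2) - 2 * ((a i * y i) * (a j * y j)))"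
    by (intro sum.cong refl) (simp add: power2_eq_square algebra_simps)
  also have "\<dots> = (\<Sum>i\<in>I. a i * (y i)\<^sup>2) * (\<Sum>j\<in>I. a j) + (\<Sum>i\<in>I. a i) * (\<Sum>j\<in>I. a j * (y j)\<^sup>2)
      - 2 * ((\<Sum>i\<in>I. a i * y i) * (\<Sum>j\<in>I. a j * y j))"
    by (simp only: sum.distrib sum_subtractf sum_distrib_left[symmetric] sum_product)
  finally show ?thesis
    using assms by (simp add: power2_eq_square)
qed

text \<open>The gaps with index in \<open>F\<close> are non-overlapping intervals inside
  \<open>[a, b]\<close>, so their lengths add up to at most \<open>b - a\<close>, and each single
  length is at most \<open>b - a\<close> as well.\<close>

lemma sum_squared_gaps_le:
  fixes l :: "nat \<Rightarrow> real"
  assumes mono: "mono_on {..m} l" and F: "F \<subseteq> {..<m}" and "a \<le> b"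
    and bounds: "\<And>d. d \<in> F \<Longrightarrow> a \<le> l d \<and> l (Suc d) \<le> b"
  shows "(\<Sum>d\<in>F. (l (Suc d) - l d)\<^sup>2) \<le> (b - a)\<^sup>2"
proof (cases "F = {}")
  case False
  have fin: "finite F" using F finite_subset by blast
  have gap: "l d \<le> l (Suc d)" if "d < m" for d
    using that by (intro mono_onD[OF mono]) auto
  define p q where "p = Min F" and "q = Max F"
  have pq: "p \<in> F" "q \<in> F" "F \<subseteq> {p..q}" "p \<le> q"
    using fin False by (auto simp: p_def q_def)
  have "q < m" using pq F by auto
  \<comment> \<open>The gaps missing from \<open>F\<close> between its extreme indices are
    nonnegative; once they are added, the sum telescopes.\<close>
  have "(\<Sum>d\<in>F. l (Suc d) - l d) \<le> (\<Sum>d=p..q. l (Suc d) - l d)"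
    using pq \<open>q < m\<close> by (intro sum_mono2) (auto intro!: gap)
  also have "\<dots> = l (Suc q) - l p"
    using pq by (intro sum_Suc_diff) auto
  also have "\<dots> \<le> b - a"
    using bounds[of p] bounds[of q] pq by auto
  finally have total: "(\<Sum>d\<in>F. l (Suc d) - l d) \<le> b - a" .
  have "(\<Sum>d\<in>F. (l (Suc d) - l d)\<^sup>2) \<le> (\<Sum>d\<in>F. (l (Suc d) - l d) * (b - a))"
  proof (rule sum_mono)
    fix d assume "d \<in> F"
    then have "d < m" using F by auto
    then show "(l (Suc d) - l d)\<^sup>2 \<le> (l (Suc d) - l d) * (b - a)"
      unfolding power2_eq_square using bounds[OF \<open>d \<in> F\<close>] gap[of d] by (intro mult_left_mono) auto
  qed
  also have "\<dots> = (\<Sum>d\<in>F. l (Suc d) - l d) * (b - a)"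
    by (simp add: sum_distrib_right)
  also have "\<dots> \<le> (b - a)\<^sup>2"
    unfolding power2_eq_square using total \<open>a \<le> b\<close> by (intro mult_right_mono) auto
  finally show ?thesis .
qed simp

lemma finite_real_enumeration:
  fixes Y :: "real set"
  assumes "finite Y" "Y \<noteq> {}"
  obtains l and m :: nat where "m < card Y" "strict_mono_on {..m} l" "l ` {..m} = Y"
proof
  let ?L = "sorted_list_of_set Y" and ?m = "card Y - 1"
  have pos: "card Y > 0" using assms card_gt_0_iff by blast
  then show "?m < card Y" by simp
  have le: "{..?m} = {..<length ?L}" using pos by auto
  show "strict_mono_on {..?m} ((!) ?L)"
    unfolding le using strict_sorted_list_of_set[of Y]
    by (auto intro!: strict_mono_onI simp: sorted_wrt_iff_nth_less)
  show "(!) ?L ` {..?m} = Y"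
    unfolding le using assms(1)
    by (metis set_sorted_list_of_set set_conv_nth lessThan_def image_Collect)
qed

lemma rtrancl_crosses_cut:
  assumes "(i, j) \<in> R\<^sup>*" "i \<in> S" "j \<notin> S"
  obtains a b where "(a, b) \<in> R" "a \<in> S" "b \<notin> S"
  using assms by (induction rule: rtrancl_induct) auto

section \<open>Averaging steps and the energy they dissipate\<close>

context consensus_network
begin

lemma weight_nonneg: "k \<ge> 1 \<Longrightarrow> i \<in> {1..V} \<Longrightarrow> j \<in> {1..V} \<Longrightarrow> 0 \<le> A k i j"
  using weight_range[of k i j] by auto

lemma weight_eq_0: "k \<ge> 1 \<Longrightarrow> i \<in> {1..V} \<Longrightarrow> j \<in> {1..V} \<Longrightarrow> (i, j) \<notin> E k \<Longrightarrow> A k i j = 0"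
  using weight_nonneg[of k i j] weight_pos_iff[of k i j] by auto

lemma edge_weight: "k \<ge> 1 \<Longrightarrow> (i, j) \<in> E k \<Longrightarrow> A k i j \<ge> \<alpha>"
  using edges[of k] weight_lower_bound[of k i j] weight_pos_iff[of k i j] by blast

text \<open>Since no edge leaves \<open>S\<close>, row \<open>i\<close> puts its whole weight on
  \<open>S\<close> and forms a convex combination of values there. With all nodes as
  \<open>S\<close> this keeps averages in \<open>X\<close>; with one side of a cut and a half-line
  it preserves a gap.\<close>

lemma averaging_in_convex:
  fixes y :: "nat \<Rightarrow> 'a::real_vector"
  assumes "k \<ge> 1" "S \<subseteq> {1..V}" "i \<in> S" "convex C" "\<And>j. j \<in> S \<Longrightarrow> y j \<in> C"
    and no_exit: "\<And>i j. (i, j) \<in> E k \<Longrightarrow> i \<in> S \<Longrightarrow> j \<in> S"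
  shows "(\<Sum>j\<in>{1..V}. A k i j *\<^sub>R y j) \<in> C"
proof -
  have i: "i \<in> {1..V}" using assms by auto
  have 0: "A k i j = 0" if "j \<in> {1..V} - S" for j
    using weight_eq_0[of k i j] no_exit[of i j] that assms i by auto
  have "(\<Sum>j\<in>{1..V}. A k i j *\<^sub>R y j) = (\<Sum>j\<in>S. A k i j *\<^sub>R y j)"
    using 0 assms by (intro sum.mono_neutral_right) auto
  moreover have "(\<Sum>j\<in>S. A k i j) = (\<Sum>j\<in>{1..V}. A k i j)"
    using 0 assms by (intro sum.mono_neutral_left) auto
  moreover have "(\<Sum>j\<in>S. A k i j *\<^sub>R y j) \<in> C"
  proof (rule convex_sum)
    show "finite S" using assms(2) finite_subset by blast
    show "(\<Sum>j\<in>S. A k i j) = 1"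
      using calculation(2) row_stochastic[of k i] assms i by auto
    show "\<And>j. j \<in> S \<Longrightarrow> 0 \<le> A k i j"
      using weight_nonneg[of k i] assms i by blast
  qed (use assms in auto)
  ultimately show ?thesis by simp
qed

definition energy :: "(nat \<Rightarrow> real) \<Rightarrow> real" where
  "energy y = (\<Sum>i\<in>{1..V}. (y i)\<^sup>2)"

definition average :: "nat \<Rightarrow> (nat \<Rightarrow> real) \<Rightarrow> nat \<Rightarrow> real" where
  "average k y i = (\<Sum>j\<in>{1..V}. A k i j * y j)"

text \<open>Column sums equal to 1 turn the energy of \<open>y\<close> into the sum of its second
  moments over all rows, so the drop is a sum of row variances.\<close>

lemma energy_drop_rows:
  assumes "k \<ge> 1"
  shows "energy y - energy (average k y)
    = (\<Sum>r\<in>{1..V}. (\<Sum>i\<in>{1..V}. A k r i * (y i)\<^sup>2) - (\<Sum>i\<in>{1..V}. A k r i * y i)\<^sup>2)"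
proof -
  have "(\<Sum>r\<in>{1..V}. \<Sum>i\<in>{1..V}. A k r i * (y i)\<^sup>2) = (\<Sum>i\<in>{1..V}. (\<Sum>r\<in>{1..V}. A k r i) * (y i)\<^sup>2)"
    by (subst sum.swap) (simp add: sum_distrib_right)
  also have "\<dots> = energy y"
    unfolding energy_def using column_stochastic[OF assms] by (intro sum.cong) auto
  finally show ?thesis
    by (simp add: energy_def average_def sum_subtractf)
qed

lemma energy_drop:
  assumes "k \<ge> 1"
  shows "energy y - energy (average k y)
    = (\<Sum>r\<in>{1..V}. \<Sum>i\<in>{1..V}. \<Sum>j\<in>{1..V}. A k r i * A k r j * (y i - y j)\<^sup>2) / 2"
  unfolding energy_drop_rows[OF assms] sum_divide_distrib[of _ _ 2]
  using weighted_variance[OF row_stochastic[OF assms]] by (intro sum.cong) (auto simp: sum_divide_distrib)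

lemma energy_average_le:
  assumes "k \<ge> 1"
  shows "energy (average k y) \<le> energy y"
proof -
  have "0 \<le> energy y - energy (average k y)"
    unfolding energy_drop[OF assms] using weight_nonneg[OF assms]
    by (auto intro!: sum_nonneg mult_nonneg_nonneg divide_nonneg_nonneg)
  then show ?thesis by simp
qed

text \<open>For an indicator the variance in row \<open>r\<close> is \<open>C r * (1 - C r)\<close>,
  where \<open>C r\<close> is the weight that the row puts on \<open>S\<close>. The row of the tail
  \<open>a\<close> of the crossing edge alone contributes enough.\<close>

lemma energy_drop_cut:
  assumes k: "k \<ge> 1" and edge: "(a, b) \<in> E k" and cross: "(a \<in> S) \<noteq> (b \<in> S)"
  shows "\<alpha> / 2 \<le> energy (indicator S) - energy (average k (indicator S))"
proof -
  let ?h = "indicator S :: nat \<Rightarrow> real"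
  define C where "C r = (\<Sum>i\<in>{1..V}. A k r i * ?h i)" for r
  have row: "(\<Sum>i\<in>{1..V}. A k r i * (?h i)\<^sup>2) - (\<Sum>i\<in>{1..V}. A k r i * ?h i)\<^sup>2 = C r * (1 - C r)" for r
  proof -
    have "(?h i)\<^sup>2 = ?h i" for i by (simp add: indicator_def)
    then show ?thesis by (simp add: C_def power2_eq_square algebra_simps)
  qed
  have ab: "a \<in> {1..V}" "b \<in> {1..V}" using edges[OF k] edge by auto
  have co: "1 - C r = (\<Sum>i\<in>{1..V}. A k r i * indicator (- S) i)" if "r \<in> {1..V}" for r
  proof -
    have "1 - C r = (\<Sum>i\<in>{1..V}. A k r i) - C r" using row_stochastic[OF k that] by simp
    also have "\<dots> = (\<Sum>i\<in>{1..V}. A k r i * indicator (- S) i)"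
      unfolding C_def sum_subtractf[symmetric] by (intro sum.cong) (auto simp: indicator_def)
    finally show ?thesis .
  qed
  have nonneg: "0 \<le> (\<Sum>i\<in>{1..V}. A k r i * indicator T i)" if "r \<in> {1..V}" for r T
    using weight_nonneg[OF k that] by (intro sum_nonneg) auto
  have hit: "\<alpha> \<le> (\<Sum>i\<in>{1..V}. A k a i * indicator T i)" if "i0 \<in> T" "(a, i0) \<in> E k" for T i0
  proof -
    have "\<alpha> \<le> A k a i0 * indicator T i0" using edge_weight[OF k that(2)] that(1) by simp
    also have "\<dots> \<le> (\<Sum>i\<in>{1..V}. A k a i * indicator T i)"
      using weight_nonneg[OF k ab(1)] that(2) edges[OF k] by (intro member_le_sum) auto
    finally show ?thesis .
  qed
  have loop: "(a, a) \<in> E k" using self_loop[OF k ab(1)] .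
  text \<open>Row \<open>a\<close> puts weight at least \<open>\<alpha>\<close> on both sides of the cut: by the self-loop and by the crossing edge.\<close>
  have "\<alpha> \<le> C a \<and> \<alpha> \<le> 1 - C a"
  proof (cases "a \<in> S")
    case True
    then show ?thesis using hit[of a S] hit[of b "- S"] loop edge cross unfolding co[OF ab(1)] by (auto simp: C_def)
  next
    case False
    then show ?thesis using hit[of b S] hit[of a "- S"] loop edge cross unfolding co[OF ab(1)] by (auto simp: C_def)
  qed
  \<comment> \<open>The two factors add up to 1, so one of them is at least 1/2, and the other is at
    least \<alpha>.\<close>
  then have "\<alpha> / 2 \<le> C a * (1 - C a)"
  proof (cases "C a \<le> 1 / 2")
    case True
    then have "\<alpha> * (1 / 2) \<le> C a * (1 - C a)"
      using \<open>\<alpha> \<le> C a \<and> \<alpha> \<le> 1 - C a\<close> alpha_range by (intro mult_mono) auto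
    then show ?thesis by simp
  next
    case False
    then have "(1 / 2) * \<alpha> \<le> C a * (1 - C a)"
      using \<open>\<alpha> \<le> C a \<and> \<alpha> \<le> 1 - C a\<close> alpha_range by (intro mult_mono) auto
    then show ?thesis by simp
  qed
  also have "\<dots> \<le> (\<Sum>r\<in>{1..V}. C r * (1 - C r))"
  proof (rule member_le_sum)
    fix r assume "r \<in> {1..V} - {a}"
    then show "0 \<le> C r * (1 - C r)"
      using nonneg[of r S] nonneg[of r "- S"] co[of r] by (auto simp: C_def intro!: mult_nonneg_nonneg)
  qed (use ab in auto)
  also have "\<dots> = energy ?h - energy (average k ?h)"
    unfolding energy_drop_rows[OF k] row ..
  finally show ?thesis .
qed

text \<open>The drop is a quadratic form in differences with nonnegative coefficients. As
  \<open>sep\<close> compares these differences pair by pair, the drop for \<open>y\<close>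
  dominates the \<open>g\<close>-weighted drops of the indicators, and cuts crossed in the same step
  add up.\<close>

lemma energy_drop_cuts:
  assumes k: "k \<ge> 1" and fin: "finite D" and g: "\<And>d. d \<in> D \<Longrightarrow> 0 \<le> g d"
    and cross: "\<And>d. d \<in> D \<Longrightarrow> \<exists>(a, b)\<in>E k. (a \<in> S d) \<noteq> (b \<in> S d)"
    and sep: "\<And>i j. i \<in> {1..V} \<Longrightarrow> j \<in> {1..V} \<Longrightarrow>
      (\<Sum>d\<in>D. g d * (indicator (S d) i - indicator (S d) j)\<^sup>2) \<le> (y i - y j)\<^sup>2"
  shows "\<alpha> / 2 * (\<Sum>d\<in>D. g d) \<le> energy y - energy (average k y)"
proof -
  let ?h = "\<lambda>d. indicator (S d) :: nat \<Rightarrow> real"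
  have "\<alpha> / 2 * (\<Sum>d\<in>D. g d) \<le> (\<Sum>d\<in>D. g d * (energy (?h d) - energy (average k (?h d))))"
    unfolding sum_distrib_left
  proof (rule sum_mono)
    fix d assume d: "d \<in> D"
    obtain a b where "(a, b) \<in> E k" "(a \<in> S d) \<noteq> (b \<in> S d)" using cross[OF d] by auto
    from mult_left_mono[OF energy_drop_cut[OF k this] g[OF d]]
    show "\<alpha> / 2 * g d \<le> g d * (energy (?h d) - energy (average k (?h d)))"
      by (simp only: mult.commute)
  qed
  also have "\<dots> = (\<Sum>r\<in>{1..V}. \<Sum>i\<in>{1..V}. \<Sum>j\<in>{1..V}.
      A k r i * A k r j * (\<Sum>d\<in>D. g d * (?h d i - ?h d j)\<^sup>2)) / 2"
    unfolding energy_drop[OF k] times_divide_eq_right sum_divide_distrib[symmetric] sum_distrib_left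
    by (subst sum.swap, intro arg_cong2[where f = "(/)"] sum.cong refl,
        subst sum.swap, intro sum.cong refl, subst sum.swap) (simp add: mult_ac)
  also have "\<dots> \<le> energy y - energy (average k y)"
    unfolding energy_drop[OF k]
    using weight_nonneg[OF k] by (intro divide_right_mono sum_mono mult_left_mono sep) auto
  finally show ?thesis .
qed

section \<open>Contraction over a block of \<open>Q\<close> steps\<close>

text \<open>The state \<open>y T\<close> is formed with the matrices at times before
  \<open>s + T\<close> only, so exits from \<open>S\<close> have to be excluded just for
  \<open>t < T\<close>.\<close>

lemma trajectory_in_convex:
  fixes y :: "nat \<Rightarrow> nat \<Rightarrow> real"
  assumes s: "s \<ge> 1" and step: "\<And>t i. i \<in> {1..V} \<Longrightarrow> y (Suc t) i = average (s + t) (y t) i"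
    and S: "S \<subseteq> {1..V}" "convex C" "\<And>i. i \<in> S \<Longrightarrow> y 0 i \<in> C"
    and no_exit: "\<And>t i j. t < T \<Longrightarrow> (i, j) \<in> E (s + t) \<Longrightarrow> i \<in> S \<Longrightarrow> j \<in> S"
  shows "i \<in> S \<Longrightarrow> y T i \<in> C"
  using no_exit
proof (induction T arbitrary: i)
  case (Suc T)
  have IH: "y T j \<in> C" if "j \<in> S" for j
    using that Suc.prems(2) less_SucI by (intro Suc.IH) blast+
  have "(\<Sum>j\<in>{1..V}. A (s + T) i j *\<^sub>R y T j) \<in> C"
    by (rule averaging_in_convex[OF _ S(1) Suc.prems(1) S(2) IH])
       (use s Suc.prems(2) in auto)
  then show ?case
    using step[of i T] Suc.prems(1) S(1) by (auto simp: average_def)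
qed (use S in auto)

text \<open>Mean zero forces \<open>a \<le> 0\<close> and \<open>0 \<le> b\<close>, so every entry
  has absolute value at most \<open>b - a\<close>.\<close>

lemma energy_le_range:
  assumes "V \<ge> 1" and mean: "(\<Sum>i\<in>{1..V}. y i) = 0"
    and range: "\<And>i. i \<in> {1..V} \<Longrightarrow> a \<le> y i \<and> y i \<le> b"
  shows "energy y \<le> real V * (b - a)\<^sup>2"
proof -
  have "real V * a \<le> (\<Sum>i\<in>{1..V}. y i)" "(\<Sum>i\<in>{1..V}. y i) \<le> real V * b"
    using sum_bounded_below[of "{1..V}" a y] sum_bounded_above[of "{1..V}" y b] range by auto
  then have "a \<le> 0" "0 \<le> b"
    using mean \<open>V \<ge> 1\<close> by (auto simp: mult_le_0_iff zero_le_mult_iff)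
  then have "(y i)\<^sup>2 \<le> (b - a)\<^sup>2" if "i \<in> {1..V}" for i
    using range[OF that] by (intro power2_le_iff_abs_le[THEN iffD2]) auto
  then show ?thesis
    using sum_bounded_above[of "{1..V}" "\<lambda>i. (y i)\<^sup>2" "(b - a)\<^sup>2"] by (simp add: energy_def)
qed

lemma energy_block:
  assumes s: "s \<ge> 1" and step: "\<And>t i. i \<in> {1..V} \<Longrightarrow> y (Suc t) i = average (s + t) (y t) i"
    and mean: "(\<Sum>i\<in>{1..V}. y 0 i) = 0" and V: "V \<ge> 1"
  shows "energy (y Q) \<le> (1 - \<alpha> / (2 * (real V)\<^sup>2)) * energy (y 0)"
proof -
  have ne: "finite (y 0 ` {1..V})" "y 0 ` {1..V} \<noteq> {}" using V by auto
  obtain l and m :: nat where m: "m < card (y 0 ` {1..V})" and strict: "strict_mono_on {..m} l"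
    and l: "l ` {..m} = y 0 ` {1..V}"
    by (rule finite_real_enumeration[OF ne])
  have mono: "mono_on {..m} l" using strict by (rule strict_mono_on_imp_mono_on)
  have "m < V" using m card_image_le[of "{1..V}" "y 0"] by simp
  define S where "S d = {i\<in>{1..V}. y 0 i \<le> l d}" for d
  \<comment> \<open>Edges in both directions count, so that before the first crossing
    \<open>T d\<close> neither side of the cut uses values of the other and both sides keep their
    bounds.\<close>
  define cross where "cross d t \<longleftrightarrow> (\<exists>(a, b)\<in>E (s + t). (a \<in> S d) \<noteq> (b \<in> S d))" for d t
  define T where "T d = (LEAST t. cross d t)" for d
  define g where "g d = (l (Suc d) - l d)\<^sup>2" for d
  have above: "l (Suc d) \<le> y 0 i" if "d < m" "i \<in> {1..V} - S d" for d i
  proof -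
    have "y 0 i \<in> l ` {..m}" unfolding l using that by auto
    then obtain p where p: "p \<le> m" "y 0 i = l p" by auto
    have "\<not> p \<le> d" using that p mono_onD[OF mono, of p d] by (auto simp: S_def)
    then show ?thesis using p that mono_onD[OF mono, of "Suc d" p] by auto
  qed
  have crosses: "cross d (T d) \<and> T d < Q" if d: "d < m" for d
  proof -
    \<comment> \<open>A node of least initial value lies in \<open>S d\<close> and one of greatest
      value outside, because \<open>d < m\<close>; a path between them in the union graph of the
      block has to cross the cut.\<close>
    have "l 0 \<in> y 0 ` {1..V}" "l m \<in> y 0 ` {1..V}" unfolding l[symmetric] by auto
    then obtain i j where i: "i \<in> {1..V}" "y 0 i = l 0" and j: "j \<in> {1..V}" "y 0 j = l m"
      by (metis imageE)
    have iS: "i \<in> S d" using i d mono_onD[OF mono, of 0 d] by (auto simp: S_def)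
    have jS: "j \<notin> S d"
      using j d strict_mono_onD[OF strict, of d m] by (auto simp: S_def)
    obtain a b where ab: "(a, b) \<in> (\<Union>\<tau>\<in>{0..Q - 1}. E (s + \<tau>))" "a \<in> S d" "b \<notin> S d"
      by (rule rtrancl_crosses_cut[OF strongly_connected[OF s i(1) j(1)] iS jS])
    then obtain t where t: "t \<le> Q - 1" "(a, b) \<in> E (s + t)" by auto
    then have "cross d t" using ab by (auto simp: cross_def)
    then show ?thesis
      unfolding T_def using t Q_pos LeastI[of "cross d" t] Least_le[of "cross d" t] by auto
  qed
  \<comment> \<open>The case \<open>t = T d\<close> is included: the first crossing edge acts only
    in the passage to the next state.\<close>
  have low: "y t i \<le> l d" if "t \<le> T d" "i \<in> S d" for t d i
  proof -
    have "y t i \<in> {..l d}"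
    proof (rule trajectory_in_convex[OF s step, of "S d"])
      fix t' i j assume "t' < t" "(i, j) \<in> E (s + t')" "i \<in> S d"
      then show "j \<in> S d" using that not_less_Least[of t' "cross d"] unfolding T_def cross_def by auto
    qed (use that in \<open>auto simp: S_def\<close>)
    then show ?thesis by simp
  qed
  have high: "l (Suc d) \<le> y t i" if "t \<le> T d" "d < m" "i \<in> {1..V} - S d" for t d i
  proof -
    have "y t i \<in> {l (Suc d)..}"
    proof (rule trajectory_in_convex[OF s step, of "{1..V} - S d"])
      fix t' i j assume *: "t' < t" "(i, j) \<in> E (s + t')" "i \<in> {1..V} - S d"
      then have "j \<in> {1..V}" using edges[of "s + t'"] s by auto
      then show "j \<in> {1..V} - S d"
        using * that not_less_Least[of t' "cross d"] unfolding T_def cross_def by auto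
    qed (use that above in auto)
    then show ?thesis by simp
  qed
  have drop: "\<alpha> / 2 * (\<Sum>d\<in>{d\<in>{..<m}. T d = t}. g d) \<le> energy (y t) - energy (y (Suc t))" for t
  proof -
    let ?D = "{d\<in>{..<m}. T d = t}"
    \<comment> \<open>The sets \<open>S d\<close> are nested, so with this ordering only cuts with
      \<open>i\<close> inside and \<open>j\<close> outside contribute. At their first crossing time
      \<open>t\<close> their gaps still lie between \<open>y t i\<close> and
      \<open>y t j\<close>.\<close>
    have sep: "(\<Sum>d\<in>?D. g d * (indicator (S d) i - indicator (S d) j)\<^sup>2) \<le> (y t i - y t j)\<^sup>2"
      if ij: "i \<in> {1..V}" "j \<in> {1..V}" "y 0 i \<le> y 0 j" for i j
    proof -
      let ?F = "{d\<in>?D. i \<in> S d \<and> j \<notin> S d}"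
      have "(\<Sum>d\<in>?D. g d * (indicator (S d) i - indicator (S d) j)\<^sup>2) = (\<Sum>d\<in>?F. g d)"
        using ij by (intro sum.mono_neutral_cong_right) (auto simp: S_def indicator_def)
      also have "\<dots> \<le> (y t j - y t i)\<^sup>2"
      proof (cases "?F = {}")
        case False
        have bounds: "y t i \<le> l d \<and> l (Suc d) \<le> y t j" if "d \<in> ?F" for d
          using that low[of t d i] high[of t d j] ij by auto
        obtain d where d: "d \<in> ?F" using False by auto
        then have "y t i \<le> y t j" using bounds[OF d] mono_onD[OF mono, of d "Suc d"] by auto
        then show ?thesis
          unfolding g_def using bounds by (intro sum_squared_gaps_le[OF mono]) auto
      next
        case True
        show ?thesis unfolding True by simp
      qed
      finally show ?thesis by (simp add: power2_commute)
    qed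
    have "\<alpha> / 2 * (\<Sum>d\<in>?D. g d) \<le> energy (y t) - energy (average (s + t) (y t))"
    proof (rule energy_drop_cuts)
      fix i j assume "i \<in> {1..V}" "j \<in> {1..V}"
      then show "(\<Sum>d\<in>?D. g d * (indicator (S d) i - indicator (S d) j)\<^sup>2) \<le> (y t i - y t j)\<^sup>2"
        using sep[of i j] sep[of j i] by (cases "y 0 i \<le> y 0 j") (auto simp: power2_commute)
    qed (use s crosses in \<open>auto simp: g_def cross_def\<close>)
    also have "energy (average (s + t) (y t)) = energy (y (Suc t))"
      using step by (simp add: energy_def)
    finally show ?thesis .
  qed
  \<comment> \<open>Each cut is charged to exactly one step, its first crossing time, which is below
    \<open>Q\<close>; the drops then telescope over the block.\<close>
  have "\<alpha> / 2 * (\<Sum>d<m. g d) = (\<Sum>t<Q. \<alpha> / 2 * (\<Sum>d\<in>{d\<in>{..<m}. T d = t}. g d))"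
    unfolding sum_distrib_left[symmetric] using crosses by (subst sum.group) auto
  also have "\<dots> \<le> (\<Sum>t<Q. energy (y t) - energy (y (Suc t)))"
    by (intro sum_mono drop)
  also have "\<dots> = energy (y 0) - energy (y Q)"
    using sum_lessThan_telescope'[of "\<lambda>t. energy (y t)" Q] by simp
  finally have total: "\<alpha> / 2 * (\<Sum>d<m. g d) \<le> energy (y 0) - energy (y Q)" .
  have range: "energy (y 0) \<le> real V * (l m - l 0)\<^sup>2"
  proof (rule energy_le_range[OF V mean])
    fix i assume "i \<in> {1..V}"
    then have "y 0 i \<in> l ` {..m}" unfolding l by auto
    then obtain p where "p \<le> m" "y 0 i = l p" by auto
    then show "l 0 \<le> y 0 i \<and> y 0 i \<le> l m" by (auto intro!: mono_onD[OF mono])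
  qed
  \<comment> \<open>Cauchy-Schwarz over the \<open>m\<close> gaps; \<open>m < V\<close> because
    there are at most \<open>V\<close> distinct values.\<close>
  have "(l m - l 0)\<^sup>2 = (\<Sum>d<m. l (Suc d) - l d)\<^sup>2"
    by (simp add: sum_lessThan_telescope)
  also have "\<dots> \<le> real m * (\<Sum>d<m. g d)"
    using sum_squared_le_sum_of_squares[of "\<lambda>d. l (Suc d) - l d" "{..<m}"] by (simp add: g_def mult.commute)
  also have "\<dots> \<le> real V * (\<Sum>d<m. g d)"
    using \<open>m < V\<close> by (intro mult_right_mono sum_nonneg) (auto simp: g_def)
  finally have "energy (y 0) \<le> real V * (real V * (\<Sum>d<m. g d))"
    using order_trans[OF range mult_left_mono] by simp
  then have "energy (y 0) / (real V)\<^sup>2 \<le> (\<Sum>d<m. g d)"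
    using V by (simp add: divide_le_eq power2_eq_square mult_ac)
  then have "\<alpha> / 2 * (energy (y 0) / (real V)\<^sup>2) \<le> \<alpha> / 2 * (\<Sum>d<m. g d)"
    using alpha_range by (intro mult_left_mono) auto
  with total have "\<alpha> / 2 * (energy (y 0) / (real V)\<^sup>2) \<le> energy (y 0) - energy (y Q)"
    by linarith
  then show ?thesis by (simp add: left_diff_distrib)
qed

text \<open>Whole blocks contract, and the remaining \<open>N mod Q\<close> steps do not increase
  the energy. Every block starts with mean zero because column sums equal to 1 preserve the
  mean.\<close>

lemma energy_blocks:
  assumes s: "s \<ge> 1" and step: "\<And>t i. i \<in> {1..V} \<Longrightarrow> y (Suc t) i = average (s + t) (y t) i"
    and mean: "(\<Sum>i\<in>{1..V}. y 0 i) = 0" and V: "V \<ge> 1"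
  shows "energy (y N) \<le> (1 - \<alpha> / (2 * (real V)\<^sup>2)) ^ (N div Q) * energy (y 0)"
proof -
  let ?r = "1 - \<alpha> / (2 * (real V)\<^sup>2)"
  have mean: "(\<Sum>i\<in>{1..V}. y t i) = 0" for t
  proof (induction t)
    case (Suc t)
    have "(\<Sum>i\<in>{1..V}. y (Suc t) i) = (\<Sum>i\<in>{1..V}. \<Sum>j\<in>{1..V}. A (s + t) i j * y t j)"
      using step by (simp add: average_def)
    also have "\<dots> = (\<Sum>j\<in>{1..V}. (\<Sum>i\<in>{1..V}. A (s + t) i j) * y t j)"
      by (subst sum.swap) (simp add: sum_distrib_right)
    also have "\<dots> = 0"
      using Suc s column_stochastic[of "s + t"] by simp
    finally show ?case .
  qed (use mean in simp)
  have r: "?r \<ge> 0"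
  proof -
    have "\<alpha> \<le> 2 * (real V)\<^sup>2" using alpha_range V one_le_power[of "real V" 2] by linarith
    then show ?thesis using V by (simp add: divide_le_eq)
  qed
  have blocks: "energy (y (n * Q)) \<le> ?r ^ n * energy (y 0)" for n
  proof (induction n)
    case (Suc n)
    have "energy (y (n * Q + Q)) \<le> ?r * energy (y (n * Q))"
      using energy_block[of "s + n * Q" "\<lambda>t. y (n * Q + t)"] s step mean V by (simp add: add_ac)
    also have "\<dots> \<le> ?r * (?r ^ n * energy (y 0))"
      using Suc r by (intro mult_left_mono)
    finally show ?case by (simp add: add.commute mult.assoc)
  qed simp
  have "energy (y (t + n)) \<le> energy (y t)" for t n
  proof (induction n)
    case (Suc n)
    have "energy (y (Suc (t + n))) = energy (average (s + (t + n)) (y (t + n)))"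
      using step by (simp add: energy_def)
    then show ?case using Suc energy_average_le[of "s + (t + n)" "y (t + n)"] s by simp
  qed simp
  from this[of "N div Q * Q" "N mod Q"] show ?thesis
    using blocks[of "N div Q"] by simp
qed

section \<open>Products of weight matrices\<close>

text \<open>\<open>transition s N\<close> is the matrix product \<open>A (s + N - 1) \<cdots> A s\<close>.\<close>

fun transition :: "nat \<Rightarrow> nat \<Rightarrow> nat \<Rightarrow> nat \<Rightarrow> real" where
  "transition s 0 i j = of_bool (i = j)"
| "transition s (Suc N) i j = average (s + N) (\<lambda>l. transition s N l j) i"

lemma transition_column_sum:
  assumes "s \<ge> 1" "j \<in> {1..V}"
  shows "(\<Sum>i\<in>{1..V}. transition s N i j) = 1"
proof (induction N)
  case (Suc N)
  have "(\<Sum>i\<in>{1..V}. transition s (Suc N) i j)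
      = (\<Sum>l\<in>{1..V}. (\<Sum>i\<in>{1..V}. A (s + N) i l) * transition s N l j)"
    unfolding transition.simps average_def by (subst sum.swap) (simp add: sum_distrib_right)
  then show ?case
    using Suc assms column_stochastic[of "s + N"] by simp
qed (use assms in simp)

text \<open>Column \<open>j\<close> of the product minus \<open>1 / real V\<close> is a mean-zero
  trajectory of averaging with initial energy \<open>1 - 1 / real V\<close>, and the square of one
  entry is at most the energy.\<close>

lemma transition_near_uniform:
  assumes s: "s \<ge> 1" and i: "i \<in> {1..V}" and j: "j \<in> {1..V}"
  shows "\<bar>transition s N i j - 1 / real V\<bar> \<le> (1 - \<alpha> / (4 * (real V)\<^sup>2)) ^ (N div Q)"
proof -
  let ?q = "1 - \<alpha> / (4 * (real V)\<^sup>2)" and ?r = "1 - \<alpha> / (2 * (real V)\<^sup>2)"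
  define y where "y t l = transition s t l j - 1 / real V" for t l
  have V: "V \<ge> 1" using i by auto
  have "1 \<le> (real V)\<^sup>2" using V by simp
  then have "\<alpha> / (2 * (real V)\<^sup>2) \<le> 1" using alpha_range by (simp add: divide_le_eq)
  \<comment> \<open>The energy bounds squares of entries, so the rate is the square root of the
    block factor \<open>?r\<close>. It is at most \<open>?q\<close>, hence 4 in place of 2.\<close>
  moreover have "?q\<^sup>2 = ?r + (\<alpha> / (4 * (real V)\<^sup>2))\<^sup>2"
    by (simp add: power2_eq_square algebra_simps)
  ultimately have q: "0 \<le> ?r" "?r \<le> ?q\<^sup>2" "0 \<le> ?q"
    by auto
  have "energy (y N) \<le> ?r ^ (N div Q) * energy (y 0)"
  proof (rule energy_blocks[OF s _ _ V])
    fix t l assume l: "l \<in> {1..V}"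
    \<comment> \<open>Row sums equal to 1 leave the constant \<open>1 / real V\<close> fixed under
      averaging.\<close>
    have "average (s + t) (y t) l = transition s (Suc t) l j - (\<Sum>m\<in>{1..V}. A (s + t) l m) / real V"
      by (simp add: average_def y_def right_diff_distrib sum_subtractf sum_divide_distrib)
    then show "y (Suc t) l = average (s + t) (y t) l"
      using row_stochastic[of "s + t" l] s l by (simp add: y_def)
  next
    show "(\<Sum>l\<in>{1..V}. y 0 l) = 0"
      using transition_column_sum[OF s j, of 0] V by (simp add: y_def sum_subtractf)
  qed
  moreover have "energy (y 0) \<le> 1"
  proof -
    have "energy (y 0) = (\<Sum>l\<in>{1..V}. of_bool (l = j) * (1 - 2 / real V) + 1 / (real V)\<^sup>2)"
      unfolding energy_def y_def by (intro sum.cong) (auto simp: power2_eq_square field_simps)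
    also have "\<dots> = (\<Sum>l\<in>{1..V}. of_bool (l = j)) * (1 - 2 / real V) + real V * (1 / (real V)\<^sup>2)"
      by (simp only: sum.distrib sum_distrib_right sum_constant card_atLeastAtMost) simp
    also have "(\<Sum>l\<in>{1..V}. of_bool (l = j)) = (1::real)"
      using transition_column_sum[OF s j, of 0] by simp
    also have "1 * (1 - 2 / real V) + real V * (1 / (real V)\<^sup>2) = 1 - 1 / real V"
      using V by (simp add: power2_eq_square field_simps)
    finally show ?thesis by simp
  qed
  ultimately have *: "energy (y N) \<le> ?r ^ (N div Q)"
    using q(1) by (meson mult_left_le order_trans zero_le_power)
  have "(y N i)\<^sup>2 \<le> energy (y N)"
    unfolding energy_def using i by (intro member_le_sum) auto
  also have "\<dots> \<le> (?q\<^sup>2) ^ (N div Q)"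
    using * power_mono[OF q(2,1)] order_trans by blast
  also have "\<dots> = (?q ^ (N div Q))\<^sup>2"
    by (simp add: power_mult[symmetric] mult.commute)
  finally show ?thesis
    using q by (simp add: y_def power2_le_iff_abs_le)
qed

section \<open>Averaging with perturbations\<close>

text \<open>The initial state is treated as a perturbation \<open>e 0\<close> of the zero state; the state \<open>x k\<close> here
  is the state at time \<open>k + 1\<close> of the algorithm.\<close>

lemma perturbed_averaging_solution:
  fixes x e :: "nat \<Rightarrow> nat \<Rightarrow> 'a::real_vector"
  assumes step: "\<And>k i. k < n \<Longrightarrow> i \<in> {1..V} \<Longrightarrow>
      x (Suc k) i = (\<Sum>j\<in>{1..V}. A (Suc k) i j *\<^sub>R x k j) + e (Suc k) i"
    and init: "\<And>i. i \<in> {1..V} \<Longrightarrow> x 0 i = e 0 i"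
  shows "i \<in> {1..V} \<Longrightarrow> x n i = (\<Sum>s\<le>n. \<Sum>j\<in>{1..V}. transition (Suc s) (n - s) i j *\<^sub>R e s j)"
  using step
proof (induction n arbitrary: i)
  case 0
  then show ?case using init by (simp add: of_bool_def if_distrib[of "\<lambda>c. c *\<^sub>R _"] cong: if_cong)
next
  case (Suc n)
  have "(\<Sum>l\<in>{1..V}. A (Suc n) i l *\<^sub>R x n l)
      = (\<Sum>l\<in>{1..V}. \<Sum>s\<le>n. \<Sum>j\<in>{1..V}. (A (Suc n) i l * transition (Suc s) (n - s) l j) *\<^sub>R e s j)"
    using Suc by (simp add: scaleR_right.sum)
  also have "\<dots> = (\<Sum>s\<le>n. \<Sum>j\<in>{1..V}. \<Sum>l\<in>{1..V}. (A (Suc n) i l * transition (Suc s) (n - s) l j) *\<^sub>R e s j)"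
    by (subst sum.swap, rule sum.cong[OF refl], rule sum.swap)
  also have "\<dots> = (\<Sum>s\<le>n. \<Sum>j\<in>{1..V}. transition (Suc s) (Suc n - s) i j *\<^sub>R e s j)"
    by (intro sum.cong refl) (simp add: Suc_diff_le average_def scaleR_left.sum)
  finally have *: "(\<Sum>l\<in>{1..V}. A (Suc n) i l *\<^sub>R x n l)
      = (\<Sum>s\<le>n. \<Sum>j\<in>{1..V}. transition (Suc s) (Suc n - s) i j *\<^sub>R e s j)" .
  have "e (Suc n) i = (\<Sum>j\<in>{1..V}. transition (Suc (Suc n)) 0 i j *\<^sub>R e (Suc n) j)"
    using Suc.prems(1) by (simp add: of_bool_def if_distrib[of "\<lambda>c. c *\<^sub>R _"] cong: if_cong)
  then show ?case
    using Suc.prems * by simp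
qed

text \<open>By the column sums, the node average of the state is the sum of the node averages of all
  perturbations, so the deviation applies \<open>1 / real V - transition\<close> to each of them.
  For \<open>s = n\<close> the product is the identity, so the latest perturbation is kept
  apart.\<close>

lemma perturbed_averaging_deviation:
  fixes x e :: "nat \<Rightarrow> nat \<Rightarrow> real^'n"
  assumes step: "\<And>k i. k < n \<Longrightarrow> i \<in> {1..V} \<Longrightarrow>
      x (Suc k) i = (\<Sum>j\<in>{1..V}. A (Suc k) i j *\<^sub>R x k j) + e (Suc k) i"
    and init: "\<And>i. i \<in> {1..V} \<Longrightarrow> x 0 i = e 0 i"
    and i: "i \<in> {1..V}"
  shows "norm (node_average V (x n) - x n i)
    \<le> (\<Sum>s<n. (1 - \<alpha> / (4 * (real V)\<^sup>2)) ^ ((n - s) div Q) * (\<Sum>j\<in>{1..V}. norm (e s j)))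
      + norm (node_average V (e n) - e n i)"
proof -
  let ?T = "\<lambda>s. transition (Suc s) (n - s)"
  have "(\<Sum>i\<in>{1..V}. x n i) = (\<Sum>i\<in>{1..V}. \<Sum>s\<le>n. \<Sum>j\<in>{1..V}. ?T s i j *\<^sub>R e s j)"
    using perturbed_averaging_solution[OF step init] by simp
  also have "\<dots> = (\<Sum>s\<le>n. \<Sum>j\<in>{1..V}. (\<Sum>i\<in>{1..V}. ?T s i j) *\<^sub>R e s j)"
    unfolding scaleR_left.sum by (subst sum.swap, rule sum.cong[OF refl], rule sum.swap)
  also have "\<dots> = (\<Sum>s\<le>n. \<Sum>j\<in>{1..V}. e s j)"
    using transition_column_sum by simp
  finally have "node_average V (x n) - x n i
      = (\<Sum>s\<le>n. (\<Sum>j\<in>{1..V}. (1 / real V) *\<^sub>R e s j) - (\<Sum>j\<in>{1..V}. ?T s i j *\<^sub>R e s j))"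
    using perturbed_averaging_solution[OF step init i]
    by (simp add: node_average_def scaleR_right.sum sum_subtractf)
  also have "\<dots> = (\<Sum>s\<le>n. \<Sum>j\<in>{1..V}. (1 / real V - ?T s i j) *\<^sub>R e s j)"
    by (simp add: sum_subtractf scaleR_left_diff_distrib)
  also have "\<dots> = (\<Sum>s<n. \<Sum>j\<in>{1..V}. (1 / real V - ?T s i j) *\<^sub>R e s j) + (node_average V (e n) - e n i)"
  proof -
    have "(\<Sum>j\<in>{1..V}. (1 / real V - ?T n i j) *\<^sub>R e n j) = node_average V (e n) - e n i"
      using i by (simp add: node_average_def scaleR_left_diff_distrib scaleR_right.sum sum_subtractf
          of_bool_def if_distrib[of "\<lambda>c. c *\<^sub>R _"] cong: if_cong)
    then show ?thesis by (simp add: lessThan_Suc_atMost[symmetric])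
  qed
  finally have "norm (node_average V (x n) - x n i)
      \<le> (\<Sum>s<n. norm (\<Sum>j\<in>{1..V}. (1 / real V - ?T s i j) *\<^sub>R e s j)) + norm (node_average V (e n) - e n i)"
    by (simp add: norm_triangle_le sum_norm_le)
  also have "(\<Sum>s<n. norm (\<Sum>j\<in>{1..V}. (1 / real V - ?T s i j) *\<^sub>R e s j))
      \<le> (\<Sum>s<n. (1 - \<alpha> / (4 * (real V)\<^sup>2)) ^ ((n - s) div Q) * (\<Sum>j\<in>{1..V}. norm (e s j)))"
    unfolding sum_distrib_left
    using transition_near_uniform[OF _ i]
    by (intro sum_mono sum_norm_le) (auto intro!: mult_right_mono simp: abs_minus_commute)
  finally show ?thesis by simp
qed

section \<open>Passage to the constants \<open>consensus_theta\<close> and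
  \<open>consensus_beta\<close>\<close>

lemma contraction_factor_pos:
  assumes "V \<ge> 1"
  shows "0 < 1 - \<alpha> / (4 * (real V)\<^sup>2)"
proof -
  have "1 \<le> (real V)\<^sup>2" using assms by simp
  then have "\<alpha> < 4 * (real V)\<^sup>2" using alpha_range by linarith
  then show ?thesis using assms by (simp add: divide_less_eq)
qed

text \<open>Rounding costs less than one block, so \<open>N div Q\<close> is at least
  \<open>(N - 1) / Q - 2\<close> in real division. The base is at most 1, so lowering the exponent
  raises the power; the summand -2 yields the first constant and the rest the second.\<close>

lemma contraction_le_consensus_rate:
  assumes "V \<ge> 1" "N \<ge> 1"
  shows "(1 - \<alpha> / (4 * (real V)\<^sup>2)) ^ (N div Q)
    \<le> consensus_theta V \<alpha> * consensus_beta V \<alpha> Q ^ (N - 1)"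
proof -
  let ?q = "1 - \<alpha> / (4 * (real V)\<^sup>2)"
  have q: "0 < ?q" "?q \<le> 1" using contraction_factor_pos[OF assms(1)] alpha_range by auto
  have "real N = real (N div Q) * real Q + real (N mod Q)"
    by (metis div_mult_mod_eq of_nat_add of_nat_mult)
  moreover have "real (N mod Q) < real Q" using Q_pos by simp
  ultimately have "real N \<le> (real (N div Q) + 1) * real Q" by (simp add: algebra_simps)
  then have "real N / real Q \<le> real (N div Q) + 1" using Q_pos by (simp add: divide_le_eq)
  moreover have "(real N - 1) / real Q \<le> real N / real Q" by (simp add: divide_right_mono)
  ultimately have "- 2 + (1 / real Q) * (real N - 1) \<le> real (N div Q)" by simp
  then have "?q powr real (N div Q) \<le> ?q powr (- 2 + (1 / real Q) * (real N - 1))"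
    using q by (intro powr_mono') auto
  also have "\<dots> = ?q powr (- 2) * ?q powr ((1 / real Q) * (real N - 1))"
    by (rule powr_add)
  also have "?q powr (- 2) = consensus_theta V \<alpha>"
    unfolding consensus_theta_def
    using powr_real_of_int'[OF less_imp_le[OF q(1)] disjI1[OF less_imp_neq[OF q(1), symmetric]], of "- 2"]
    by (simp only: of_int_minus of_int_numeral)
  also have "?q powr ((1 / real Q) * (real N - 1)) = consensus_beta V \<alpha> Q ^ (N - 1)"
  proof -
    have "real N - 1 = real (N - 1)" using assms(2) by simp
    moreover have "?q powr (1 / real Q) > 0" using q(1) by (metis powr_gt_zero less_irrefl)
    ultimately show ?thesis
      unfolding consensus_beta_def powr_powr[symmetric] by (simp only: powr_realpow)
  qed
  finally show ?thesis using q by (simp add: powr_realpow)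
qed

lemma consensus_theta_pos: "V \<ge> 1 \<Longrightarrow> consensus_theta V \<alpha> > 0"
  unfolding consensus_theta_def by (intro zero_less_power_int contraction_factor_pos)

end

section \<open>The perturbation caused by one outer iteration\<close>

text \<open>Accounts for the factor 2 in the last term of the error bound, which stems from the
  latest perturbation.\<close>

lemma norm_node_average_diff_le:
  fixes e :: "nat \<Rightarrow> real^'n"
  assumes e: "\<And>j. j \<in> {1..V} \<Longrightarrow> norm (e j) \<le> c" and i: "i \<in> {1..V}"
  shows "norm (node_average V e - e i) \<le> 2 * c"
proof -
  have "norm (\<Sum>j\<in>{1..V}. e j) \<le> real V * c"
    using sum_norm_le[of "{1..V}" e "\<lambda>_. c"] e by simp
  then have "norm (node_average V e) \<le> c"
    using i by (simp add: node_average_def divide_le_eq mult.commute)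
  then show ?thesis
    using norm_triangle_ineq4[of "node_average V e" "e i"] e[OF i] by simp
qed

text \<open>The result is either the starting point or the projection computed last;
  \<open>z0\<close> witnesses that \<open>B\<close> is non-empty, so \<open>closest_point\<close>
  lies in it.\<close>

lemma inner_descent_in:
  assumes "inner_descent U f gradf B tol z0 y" "closed B" "z0 \<in> B"
  shows "y \<in> B"
proof -
  from assms(1) obtain L :: nat and zb ub where L: "L \<ge> 1" "zb 1 = z0" "y = zb L"
    and step: "\<And>l. l \<in> {1..<L} \<Longrightarrow> zb (l + 1) = closest_point B
                (zb l - (f (zb l) (ub l) / (norm (gradf (zb l) (ub l)))\<^sup>2) *\<^sub>R gradf (zb l) (ub l))"
    unfolding inner_descent_def by auto
  show ?thesis
  proof (cases "L = 1")
    case False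
    then have "y = zb (L - 1 + 1)" "L - 1 \<in> {1..<L}" using L by auto
    then show ?thesis using step[of "L - 1"] closest_point_in_set[OF assms(2)] assms(3) by (metis empty_iff)
  qed (use L assms in auto)
qed

context dagd_run
begin

lemma stepsize_nonneg: "0 \<le> stepsize X k"
  using diameter_ge_0[OF compact_imp_bounded[OF compact_X]] by (simp add: stepsize_def)

lemma norm_subgradient_le: "i \<in> {1..V} \<Longrightarrow> a \<in> X \<Longrightarrow> norm (F' i a) \<le> subgrad_bound V X F'"
  unfolding subgrad_bound_def
  using cSUP_upper[OF _ bounded_subgradients, of "(i, a)"] by simp

lemma subgrad_bound_nonneg: "0 \<le> subgrad_bound V X F'"
proof -
  obtain a where "a \<in> X" using interior_X interior_subset by blast
  then show ?thesis
    using order_trans[OF norm_ge_zero norm_subgradient_le[of 1 a]] V_pos by simp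
qed

text \<open>Projection onto \<open>X\<close> is nonexpansive and fixes \<open>v k i\<close>, so
  \<open>z k i\<close> is within stepsize times subgradient bound of it. The ball used in the inner
  loop adds its radius.\<close>

lemma iterate_step:
  assumes k: "k \<in> {1..K}" and i: "i \<in> {1..V}" and inX: "\<And>j. j \<in> {1..V} \<Longrightarrow> x k j \<in> X"
  shows "x (k + 1) i \<in> X"
    and "norm (x (k + 1) i - v k i) \<le> 2 * stepsize X k * subgrad_bound V X F' + tolerance k / G0"
proof -
  let ?G = "subgrad_bound V X F'"
  let ?B = "{y\<in>X. norm (y - z k i) \<le> stepsize X k * ?G + tolerance k / G0}"
  have X: "closed X" "X \<noteq> {}" using compact_X compact_imp_closed interior_X by auto
  have v: "v k i \<in> X"
    unfolding averaging[OF k i]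
  proof (rule averaging_in_convex[OF _ order_refl i convex_X inX])
    show "j \<in> {1..V}" if "(i, j) \<in> E k" for i j
      using edges[of k] k that by auto
  qed (use k in auto)
  have z: "z k i \<in> X"
    unfolding outer_step[OF k i] using closest_point_in_set[OF X] .
  have "norm (z k i - v k i) = dist (closest_point X (v k i - stepsize X k *\<^sub>R F' i (v k i))) (closest_point X (v k i))"
    using v outer_step[OF k i] by (simp add: dist_norm closest_point_self)
  also have "\<dots> \<le> norm (stepsize X k *\<^sub>R F' i (v k i))"
    using closest_point_lipschitz[OF convex_X X, of "v k i - stepsize X k *\<^sub>R F' i (v k i)" "v k i"]
    by (simp add: dist_norm)
  also have "\<dots> \<le> stepsize X k * ?G"
    using norm_subgradient_le[OF i v] stepsize_nonneg by (simp add: mult_left_mono)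
  finally have zv: "norm (z k i - v k i) \<le> stepsize X k * ?G" .
  have "?B = X \<inter> cball (z k i) (stepsize X k * ?G + tolerance k / G0)"
    by (auto simp: dist_norm norm_minus_commute)
  then have "closed ?B" using X by auto
  moreover have "z k i \<in> ?B"
    using z stepsize_nonneg subgrad_bound_nonneg G0_pos by (simp add: tolerance_def)
  ultimately have "x (k + 1) i \<in> ?B"
    by (rule inner_descent_in[OF inner_step[OF k i]])
  then show "x (k + 1) i \<in> X"
    and "norm (x (k + 1) i - v k i) \<le> 2 * stepsize X k * ?G + tolerance k / G0"
    using zv norm_triangle_ineq[of "x (k + 1) i - z k i" "z k i - v k i"] by auto
qed

lemma iterate_in_X: "k \<le> K \<Longrightarrow> i \<in> {1..V} \<Longrightarrow> x (Suc k) i \<in> X"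
proof (induction k arbitrary: i)
  case (Suc k)
  then show ?case using iterate_step(1)[of "Suc k" i] by simp
qed (use initial in simp)

section \<open>Assembly of the error bound\<close>

lemma deviation_le_consensus_error:
  assumes k: "k \<in> {1..K}" and i: "i \<in> {1..V}"
  shows "norm (node_average V (x (k + 1)) - x (k + 1) i) \<le> consensus_error V X F' G0 \<alpha> Q (x 1) k"
proof -
  define c where "c s = 2 * stepsize X s * subgrad_bound V X F' + tolerance s / G0" for s
  \<comment> \<open>Index 0 holds the initial states, as the unrolled recursion starts from zero;
    the other \<open>e s\<close> lead from the averages \<open>v s\<close> to the next iterates and
    are bounded by \<open>c s\<close>.\<close>
  define e where "e s j = (if s = 0 then x 1 j else x (s + 1) j - v s j)" for s j
  define R where "R N = consensus_theta V \<alpha> * consensus_beta V \<alpha> Q ^ (N - 1)" for N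
  have e: "norm (e s j) \<le> c s" if "s \<in> {1..k}" "j \<in> {1..V}" for s j
  proof -
    have "x s l \<in> X" if "l \<in> {1..V}" for l
    proof -
      have "s - 1 \<le> K" "Suc (s - 1) = s" using \<open>s \<in> {1..k}\<close> k by auto
      then show ?thesis using iterate_in_X[of "s - 1" l] that by metis
    qed
    then show ?thesis
      using iterate_step(2)[of s j] that k by (auto simp: e_def c_def)
  qed
  have rate: "(1 - \<alpha> / (4 * (real V)\<^sup>2)) ^ ((k - s) div Q) * r \<le> R (k - s) * r'"
    if "s < k" "r \<le> r'" "0 \<le> r" for s r r'
    unfolding R_def using that contraction_le_consensus_rate[OF V_pos, of "k - s"] consensus_theta_pos[OF V_pos]
    by (intro mult_mono) (auto simp: consensus_beta_def)
  have "norm (node_average V (x (Suc k)) - x (Suc k) i)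
    \<le> (\<Sum>s<k. (1 - \<alpha> / (4 * (real V)\<^sup>2)) ^ ((k - s) div Q) * (\<Sum>j\<in>{1..V}. norm (e s j)))
      + norm (node_average V (e k) - e k i)"
    using k i averaging
    by (intro perturbed_averaging_deviation[of k "\<lambda>k. x (Suc k)" e]) (auto simp: e_def)
  also have "norm (node_average V (e k) - e k i) \<le> 2 * c k"
    using e k i by (intro norm_node_average_diff_le) auto
  also have "(\<Sum>s<k. (1 - \<alpha> / (4 * (real V)\<^sup>2)) ^ ((k - s) div Q) * (\<Sum>j\<in>{1..V}. norm (e s j)))
    \<le> (\<Sum>s<k. R (k - s) * (if s = 0 then \<Sum>j\<in>{1..V}. norm (x 1 j) else real V * c s))"
  proof (intro sum_mono rate)
    fix s assume "s \<in> {..<k}"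
    then have "(\<Sum>j\<in>{1..V}. norm (e s j)) \<le> real V * c s" if "s \<noteq> 0"
      using that e sum_bounded_above[of "{1..V}" "\<lambda>j. norm (e s j)" "c s"] by auto
    then show "(\<Sum>j\<in>{1..V}. norm (e s j)) \<le> (if s = 0 then \<Sum>j\<in>{1..V}. norm (x 1 j) else real V * c s)"
      by (auto simp: e_def)
  qed (auto intro: sum_nonneg)
  \<comment> \<open>Index 0 yields the term with the initial norms and exponent
    \<open>k - 1\<close>; for \<open>k = 1\<close> the other indices are absent.\<close>
  also have "{..<k} = insert 0 {1..k - 1}" using k by auto
  also have "(\<Sum>s\<in>insert 0 {1..k - 1}. R (k - s) * (if s = 0 then \<Sum>j\<in>{1..V}. norm (x 1 j) else real V * c s))
    = R k * (\<Sum>j\<in>{1..V}. norm (x 1 j)) + (\<Sum>s\<in>{1..k - 1}. R (k - s) * (real V * c s))"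
    by simp
  also have "(\<Sum>s\<in>{1..k - 1}. R (k - s) * (real V * c s))
    = real V * consensus_theta V \<alpha> * (\<Sum>s\<in>{1..k - 1}. consensus_beta V \<alpha> Q ^ (k - s - 1) * c s)"
    unfolding sum_distrib_left by (intro sum.cong) (auto simp: R_def)
  finally show ?thesis
    by (simp add: consensus_error_def Let_def R_def c_def)
qed

end

theorem lemma3p9:
  fixes V Q K k :: nat
    and X :: "(real^'n) set" and U :: "(real^'m) set"
    and F :: "nat \<Rightarrow> real^'n \<Rightarrow> real" and F' :: "nat \<Rightarrow> real^'n \<Rightarrow> real^'n"
    and f :: "real^'n \<Rightarrow> real^'m \<Rightarrow> real" and gradf :: "real^'n \<Rightarrow> real^'m \<Rightarrow> real^'n"
    and G0 \<alpha> :: real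
    and E :: "nat \<Rightarrow> (nat \<times> nat) set" and A :: "nat \<Rightarrow> nat \<Rightarrow> nat \<Rightarrow> real"
    and x v z :: "nat \<Rightarrow> nat \<Rightarrow> real^'n"
  assumes "dagd_run V X U F F' f gradf G0 E A \<alpha> Q K x v z"
    and "k \<in> {1..K}"
  shows "(\<forall>i\<in>{1..V}. norm (node_average V (x (k + 1)) - x (k + 1) i)
             \<le> consensus_error V X F' G0 \<alpha> Q (x 1) k)
       \<and> (\<forall>i\<in>{1..V}. \<forall>j\<in>{1..V}. norm (x (k + 1) j - x (k + 1) i)
             \<le> 2 * consensus_error V X F' G0 \<alpha> Q (x 1) k)"
proof -
  interpret dagd_run V X U F F' f gradf G0 E A \<alpha> Q K x v z by fact
  let ?m = "node_average V (x (k + 1))"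
  note dev = deviation_le_consensus_error[OF assms(2)]
  have "norm (x (k + 1) j - x (k + 1) i) \<le> norm (?m - x (k + 1) i) + norm (?m - x (k + 1) j)" for i j
    using norm_triangle_ineq4[of "?m - x (k + 1) i" "?m - x (k + 1) j"] by simp
  then have "norm (x (k + 1) j - x (k + 1) i) \<le> 2 * consensus_error V X F' G0 \<alpha> Q (x 1) k"
    if "i \<in> {1..V}" "j \<in> {1..V}" for i j
    using dev[OF that(1)] dev[OF that(2)] by (smt (verit))
  then show ?thesis using dev by blast
qed

end
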